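(* Consider a GSWF on three alternatives satisfying the IIA condition, with choice functions $f,g,h$. If the distribution of the preferences is an even product distribution $D(\alpha,\beta,\gamma)$ and the GSWF is neutral and symmetric, then the probability $W(f,g,h)$ of an irrational choice satisfies the inequality $$W(f,g,h)\ \ge\ \Big(\frac14-d_m\Big)\Big(1+(4\alpha-1)^3+(4\beta-1)^3+(4\gamma-1)^3\Big)\ >\ 0,$$ where $d_m\approx 1/(2\pi)$ is the sum of squares of the first-level Fourier-Walsh coefficients of the majority function. In particular, $W(f,g,h)$ is bounded away from zero.
   Context: There are $n$ voters and three alternatives $A,B,C$. Each voter gives a strict linear ordering of the alternatives; a profile is the collection of the $n$ orderings. Voter $i$'s ordering is encoded by $(x_i,y_i,z_i)\in\{0,1\}^3\setminus\{(0,0,0),(1,1,1)\}$, where $x_i=1$ iff voter $i$ prefers $A$ to $B$, $y_i=1$ iff voter $i$ prefers $B$ to $C$, and $z_i=1$ iff voter $i$ prefers $C$ to $A$. A generalized social welfare function (GSWF) assigns to each profile a preference of the society on each of the three pairs of alternatives (not necessarily transitive). It satisfies Independence of Irrelevant Alternatives (IIA) if the society's preference on each pair depends only on the individual preferences on that pair; so it is given by choice functions $f,g,h:\{0,1\}^n\to\{0,1\}$: society prefers $A$ to $B$ iff $f(x)=1$, $B$ to $C$ iff $g(y)=1$, and $C$ to $A$ iff $h(z)=1$. The choice of the society is irrational for a profile if $f(x)=g(y)=h(z)=1$ or $f(x)=g(y)=h(z)=0$ (no linear ordering results), and rational otherwise. Even product distribution $D(\alpha,\beta,\gamma)$ ($\alpha,\beta,\gamma\ge0$,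 $\alpha+\beta+\gamma=1/2$): the triples $(x_i,y_i,z_i)$ are independent for different $i$, and for each $i$, $\Pr[(1,1,0)]=\Pr[(0,0,1)]=\alpha$, $\Pr[(0,1,1)]=\Pr[(1,0,0)]=\beta$, $\Pr[(1,0,1)]=\Pr[(0,1,0)]=\gamma$. The GSWF is neutral if it is invariant under permutations of the alternatives (in particular, $f=g=h$ and $f$ is balanced, i.e. has expectation $1/2$ under the uniform measure on $\{0,1\}^n$). It is symmetric if it is invariant under a transitive group of permutations of the voters. Fourier-Walsh coefficients: $\hat f(S)=2^{-n}\sum_{x\in\{0,1\}^n}f(x)\prod_{i\in S}(2x_i-1)$ for $S\subset\{1,\ldots,n\}$; the level of $\hat f(S)$ is $|S|$. The majority function on $n$ voters takes the value $1$ at $x$ if $\sum_i x_i>n/2$ and $0$ otherwise; $d_m$ is the sum over $i=1,\ldots,n$ of the squares of its coefficients at $S=\{i\}$. "Bounded away from zero" means greater than a positive constant depending only on the distribution of the preferences, and not on the number of voters or the choice functions.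
   Formalization: The claims "> 0" and "bounded away from zero" are stated for at least two voters and α, β, γ all positive; for one voter (a dictator) or when one of α, β, γ is 0, the lower bound and W are both 0, so these claims fail. *)

theory Defs
  imports "HOL-Probability.Product_PMF" "HOL-Algebra.Sym_Groups"
begin

text \<open>Voters are the numbers \<open>1, \<dots>, n\<close>. An ordering is a relation \<open>r\<close> in which
  \<open>(a, b) \<in> r\<close> means that \<open>a\<close> is preferred to \<open>b\<close>.\<close>

datatype alternative = AltA | AltB | AltC

type_synonym ordering = "alternative rel"
type_synonym profile = "nat \<Rightarrow> ordering"

definition profiles :: "nat \<Rightarrow> profile set" where
  "profiles n = {1..n} \<rightarrow>\<^sub>E {r. strict_linear_order r}"

text \<open>The preference of the society chooses exactly one direction on each of the three pairs
  (asymmetry also excludes the diagonal), but it need not be transitive.\<close>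

definition gswf :: "nat \<Rightarrow> (profile \<Rightarrow> ordering) \<Rightarrow> bool" where
  "gswf n F \<longleftrightarrow> (\<forall>p\<in>profiles n. asym (F p) \<and> total (F p))"

text \<open>The vector of individual preferences on \<open>a\<close> versus \<open>b\<close>; elements of $\{0,1\}^n$ are
  represented by Boolean vectors, with \<open>True\<close> standing for 1. The vectors $x$, $y$, $z$ of a
  profile are those for \<open>(AltA, AltB)\<close>, \<open>(AltB, AltC)\<close> and \<open>(AltC, AltA)\<close>.\<close>

definition votes :: "nat \<Rightarrow> alternative \<Rightarrow> alternative \<Rightarrow> profile \<Rightarrow> (nat \<Rightarrow> bool)" where
  "votes n a b p = (\<lambda>i\<in>{1..n}. (a, b) \<in> p i)"

definition IIA :: "nat \<Rightarrow> (profile \<Rightarrow> ordering) \<Rightarrow> bool" where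
  "IIA n F \<longleftrightarrow> (\<forall>a b. \<forall>p\<in>profiles n. \<forall>q\<in>profiles n.
     votes n a b p = votes n a b q \<longrightarrow> ((a, b) \<in> F p \<longleftrightarrow> (a, b) \<in> F q))"

type_synonym choice_function = "(nat \<Rightarrow> bool) \<Rightarrow> bool"

definition has_choice_functions ::
  "nat \<Rightarrow> (profile \<Rightarrow> ordering) \<Rightarrow> choice_function \<Rightarrow> choice_function \<Rightarrow> choice_function \<Rightarrow> bool" where
  "has_choice_functions n F f g h \<longleftrightarrow> (\<forall>p\<in>profiles n.
     ((AltA, AltB) \<in> F p \<longleftrightarrow> f (votes n AltA AltB p)) \<and>
     ((AltB, AltC) \<in> F p \<longleftrightarrow> g (votes n AltB AltC p)) \<and>
     ((AltC, AltA) \<in> F p \<longleftrightarrow> h (votes n AltC AltA p)))"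

definition rename :: "(alternative \<Rightarrow> alternative) \<Rightarrow> ordering \<Rightarrow> ordering" where
  "rename \<sigma> r = map_prod \<sigma> \<sigma> ` r"

definition neutral :: "nat \<Rightarrow> (profile \<Rightarrow> ordering) \<Rightarrow> bool" where
  "neutral n F \<longleftrightarrow> (\<forall>\<sigma>. bij \<sigma> \<longrightarrow>
     (\<forall>p\<in>profiles n. F (\<lambda>i\<in>{1..n}. rename \<sigma> (p i)) = rename \<sigma> (F p)))"

definition symmetric :: "nat \<Rightarrow> (profile \<Rightarrow> ordering) \<Rightarrow> bool" where
  "symmetric n F \<longleftrightarrow> (\<exists>G. subgroup G (sym_group n) \<and>
     (\<forall>i\<in>{1..n}. \<forall>j\<in>{1..n}. \<exists>\<pi>\<in>G. \<pi> i = j) \<and>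
     (\<forall>\<pi>\<in>G. \<forall>p\<in>profiles n. F (p \<circ> \<pi>) = F p))"

text \<open>The even product distribution $D(\alpha,\beta,\gamma)$: first the law of a single triple
  $(x_i,y_i,z_i)$, then the law of the corresponding ordering, then the independent product.\<close>

fun even_weight :: "real \<Rightarrow> real \<Rightarrow> real \<Rightarrow> bool \<times> bool \<times> bool \<Rightarrow> real" where
  "even_weight \<alpha> \<beta> \<gamma> (True, True, False) = \<alpha>"
| "even_weight \<alpha> \<beta> \<gamma> (False, False, True) = \<alpha>"
| "even_weight \<alpha> \<beta> \<gamma> (False, True, True) = \<beta>"
| "even_weight \<alpha> \<beta> \<gamma> (True, False, False) = \<beta>"
| "even_weight \<alpha> \<beta> \<gamma> (True, False, True) = \<gamma>"
| "even_weight \<alpha> \<beta> \<gamma> (False, True, False) = \<gamma>"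
| "even_weight \<alpha> \<beta> \<gamma> (True, True, True) = 0"
| "even_weight \<alpha> \<beta> \<gamma> (False, False, False) = 0"

definition even_triple_pmf :: "real \<Rightarrow> real \<Rightarrow> real \<Rightarrow> (bool \<times> bool \<times> bool) pmf" where
  "even_triple_pmf \<alpha> \<beta> \<gamma> = embed_pmf (even_weight \<alpha> \<beta> \<gamma>)"

lemma pmf_even_triple_pmf:
  assumes "\<alpha> \<ge> 0" "\<beta> \<ge> 0" "\<gamma> \<ge> 0" "\<alpha> + \<beta> + \<gamma> = 1/2"
  shows "pmf (even_triple_pmf \<alpha> \<beta> \<gamma>) t = even_weight \<alpha> \<beta> \<gamma> t"
proof -
  have nonneg: "even_weight \<alpha> \<beta> \<gamma> s \<ge> 0" for s
    by (cases "(\<alpha>, \<beta>, \<gamma>, s)" rule: even_weight.cases) (use assms in auto)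
  have univ: "(UNIV :: (bool \<times> bool \<times> bool) set) = UNIV \<times> UNIV \<times> UNIV"
    by simp
  have "(\<Sum>s\<in>UNIV. even_weight \<alpha> \<beta> \<gamma> s) = 1"
    using assms(4) unfolding univ
    by (simp add: UNIV_bool sum.cartesian_product [symmetric] del: UNIV_Times_UNIV)
  then have "(\<integral>\<^sup>+ s. ennreal (even_weight \<alpha> \<beta> \<gamma> s) \<partial>count_space UNIV) = 1"
    by (simp add: nn_integral_count_space_finite sum_ennreal nonneg)
  then show ?thesis
    unfolding even_triple_pmf_def by (intro pmf_embed_pmf nonneg)
qed

fun ordering_of_triple :: "bool \<times> bool \<times> bool \<Rightarrow> ordering" where
  "ordering_of_triple (x, y, z) =
     {if x then (AltA, AltB) else (AltB, AltA),
      if y then (AltB, AltC) else (AltC, AltB),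
      if z then (AltC, AltA) else (AltA, AltC)}"

definition even_product_pmf :: "nat \<Rightarrow> real \<Rightarrow> real \<Rightarrow> real \<Rightarrow> profile pmf" where
  "even_product_pmf n \<alpha> \<beta> \<gamma> =
     Pi_pmf {1..n} undefined (\<lambda>_. map_pmf ordering_of_triple (even_triple_pmf \<alpha> \<beta> \<gamma>))"

text \<open>The probability $W(f,g,h)$ of an irrational choice, under a distribution \<open>D\<close> of the profile.\<close>

definition irrational_prob ::
  "nat \<Rightarrow> profile pmf \<Rightarrow> choice_function \<Rightarrow> choice_function \<Rightarrow> choice_function \<Rightarrow> real" where
  "irrational_prob n D f g h = measure_pmf.prob D
     {p. (f (votes n AltA AltB p) \<and> g (votes n AltB AltC p) \<and> h (votes n AltC AltA p)) \<or>
         (\<not> f (votes n AltA AltB p) \<and> \<not> g (votes n AltB AltC p) \<and> \<not> h (votes n AltC AltA p))}"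

definition fourier_coeff :: "nat \<Rightarrow> choice_function \<Rightarrow> nat set \<Rightarrow> real" where
  "fourier_coeff n f S =
     (\<Sum>x\<in>{1..n} \<rightarrow>\<^sub>E UNIV. of_bool (f x) * (\<Prod>i\<in>S. 2 * of_bool (x i) - 1)) / 2 ^ n"

definition majority :: "nat \<Rightarrow> choice_function" where
  "majority n x \<longleftrightarrow> real (card {i\<in>{1..n}. x i}) > real n / 2"

definition d_m :: "nat \<Rightarrow> real" where
  "d_m n = (\<Sum>i=1..n. (fourier_coeff n (majority n) {i})\<^sup>2)"

end

theory Submission
  imports Defs
begin

text \<open>
  Put \<open>a = 4\<alpha> - 1\<close>, \<open>b = 4\<beta> - 1\<close>, \<open>c = 4\<gamma> - 1\<close>, the correlations of the three pairs of
  preferences of a single voter, so that \<open>a + b + c = -1\<close>. Neutrality gives \<open>f = g = h\<close> and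
  \<open>f(1 - x) = 1 - f(x)\<close>, and expanding the probability in the Walsh basis yields
  \<open>W = (\<Sum>S\<noteq>{}. f^(S)\<^sup>2 (1 + a\<^sup>k + b\<^sup>k + c\<^sup>k))\<close> with \<open>k = |S|\<close>. The factor vanishes for \<open>k = 1\<close>
  and for \<open>k \<ge> 2\<close> is smallest at \<open>k = 3\<close>, where it equals \<open>192\<alpha>\<beta>\<gamma>\<close>; hence \<open>W\<close> is at least
  \<open>192\<alpha>\<beta>\<gamma>\<close> times the Fourier weight above level one. By transitivity all first-level coefficients
  of \<open>f\<close> agree, and their sum is maximized by the majority, so the weight of level one is at most
  \<open>d_m\<close>. Finally \<open>d_m n = n (C(2k, k) / 4\<^sup>k)\<^sup>2 / 4\<close> for \<open>k = n div 2\<close>; this is at most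
  \<open>3/16\<close> for \<open>n \<ge> 2\<close> and converges to \<open>1 / (2\<pi>)\<close> by Wallis' product.
\<close>

declare One_nat_def [simp del]

section \<open>Walsh expansion\<close>

definition spin :: "bool \<Rightarrow> real" where
  "spin b = 2 * of_bool b - 1"

text \<open>Extensional functions keep the cube finite and make vectors equal as soon as they agree
  on the voters.\<close>

definition cube :: "nat \<Rightarrow> (nat \<Rightarrow> bool) set" where
  "cube n = {1..n} \<rightarrow>\<^sub>E UNIV"

definition walsh :: "nat set \<Rightarrow> (nat \<Rightarrow> bool) \<Rightarrow> real" where
  "walsh S x = (\<Prod>i\<in>S. spin (x i))"

lemma spin_simps [simp]: "spin True = 1" "spin False = -1"
  by (simp_all add: spin_def)

lemma finite_cube [simp, intro]: "finite (cube n)"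
  by (simp add: cube_def finite_PiE)

lemma card_cube: "card (cube n) = 2 ^ n"
  by (simp add: cube_def card_PiE)

lemma fourier_coeff_walsh:
  "fourier_coeff n f S = (\<Sum>x\<in>cube n. of_bool (f x) * walsh S x) / 2 ^ n"
  by (simp add: fourier_coeff_def cube_def walsh_def spin_def)

lemma fourier_coeff_cong:
  assumes "\<And>x. x \<in> cube n \<Longrightarrow> f x = g x"
  shows "fourier_coeff n f S = fourier_coeff n g S"
  using assms by (simp add: fourier_coeff_walsh)

text \<open>Expanding the product of \<open>1 + spin (x i) * spin (y i)\<close> over all voters
  yields one term for each \<open>S\<close>; a factor is 2 where \<open>x\<close> and
  \<open>y\<close> agree and 0 where they differ.\<close>

lemma sum_walsh_walsh:
  assumes "x \<in> cube n" "y \<in> cube n"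
  shows "(\<Sum>S\<in>Pow {1..n}. walsh S x * walsh S y) = (if x = y then 2 ^ n else 0)"
proof -
  have "(\<Sum>S\<in>Pow {1..n}. walsh S x * walsh S y) =
      (\<Sum>S\<in>Pow {1..n}. (\<Prod>i\<in>S. spin (x i) * spin (y i)) * (\<Prod>i\<in>{1..n} - S. 1))"
    by (simp add: walsh_def prod.distrib)
  also have "\<dots> = (\<Prod>i\<in>{1..n}. spin (x i) * spin (y i) + 1)"
    by (rule prod_add [symmetric]) simp
  also have "\<dots> = (if x = y then 2 ^ n else 0)"
  proof (cases "x = y")
    case True
    have "spin b * spin b + 1 = 2" for b
      by (cases b) simp_all
    then show ?thesis
      using True by simp
  next
    case False
    then obtain i where i: "i \<in> {1..n}" "x i \<noteq> y i"
      using assms PiE_ext [of x "{1..n}" "\<lambda>_. UNIV" y] unfolding cube_def by blast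
    then have "spin (x i) * spin (y i) + 1 = 0"
      by (cases "x i"; cases "y i") simp_all
    then have "(\<Prod>i\<in>{1..n}. spin (x i) * spin (y i) + 1) = 0"
      using i(1) by (intro prod_zero) auto
    then show ?thesis
      using False by simp
  qed
  finally show ?thesis .
qed

text \<open>Fourier inversion: after exchanging the sums, orthogonality over the sets
  \<open>S\<close> leaves only the point \<open>y = x\<close>.\<close>

lemma walsh_expansion:
  assumes "x \<in> cube n"
  shows "of_bool (f x) = (\<Sum>S\<in>Pow {1..n}. fourier_coeff n f S * walsh S x)"
proof -
  have "(\<Sum>S\<in>Pow {1..n}. fourier_coeff n f S * walsh S x) =
      (\<Sum>S\<in>Pow {1..n}. \<Sum>y\<in>cube n. of_bool (f y) / 2 ^ n * (walsh S y * walsh S x))"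
    unfolding fourier_coeff_walsh sum_distrib_right sum_divide_distrib
    by (simp only: times_divide_eq_left mult.assoc)
  also have "\<dots> = (\<Sum>y\<in>cube n. of_bool (f y) / 2 ^ n * (\<Sum>S\<in>Pow {1..n}. walsh S y * walsh S x))"
    by (subst sum.swap) (simp add: sum_distrib_left)
  also have "\<dots> = (\<Sum>y\<in>cube n. if y = x then of_bool (f y) else 0)"
    using assms by (intro sum.cong refl) (simp add: sum_walsh_walsh)
  also have "\<dots> = of_bool (f x)"
    using assms by simp
  finally show ?thesis ..
qed

lemma restrict_mem_cube [simp]: "(\<lambda>i\<in>{1..n}. b i) \<in> cube n"
  by (simp add: cube_def)

lemma walsh_expansion_restrict:
  "of_bool (f (\<lambda>i\<in>{1..n}. b i)) = (\<Sum>S\<in>Pow {1..n}. fourier_coeff n f S * walsh S (\<lambda>i\<in>{1..n}. b i))"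
  by (rule walsh_expansion [OF restrict_mem_cube])

section \<open>Expectations over independent voters\<close>

lemma expectation_prod_Pi_pmf_real:
  fixes \<phi> :: "'i \<Rightarrow> 'a \<Rightarrow> real"
  assumes "finite I" and "\<And>i. i \<in> I \<Longrightarrow> finite (set_pmf (D i))"
  shows "measure_pmf.expectation (Pi_pmf I d D) (\<lambda>p. \<Prod>i\<in>I. \<phi> i (p i)) =
         (\<Prod>i\<in>I. measure_pmf.expectation (D i) (\<phi> i))"
proof -
  have "measure_pmf.expectation (Pi_pmf I d D) (\<lambda>p. \<Prod>i\<in>I. \<phi> i (p i)) =
      (\<Prod>i\<in>I. measure_pmf.expectation (Pi_pmf I d D) (\<lambda>p. \<phi> i (p i)))"
  proof (rule prob_space.indep_vars_lebesgue_integral [OF measure_pmf.prob_space_axioms])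
    have "finite (set_pmf (Pi_pmf I d D))"
      using assms by (simp add: set_Pi_pmf finite_PiE_dflt)
    then show "integrable (measure_pmf (Pi_pmf I d D)) (\<lambda>p. \<phi> i (p i))" for i
      by (rule integrable_measure_pmf_finite)
    show "prob_space.indep_vars (measure_pmf (Pi_pmf I d D)) (\<lambda>_. borel) (\<lambda>i p. \<phi> i (p i)) I"
      using measure_pmf.prob_space_axioms indep_vars_Pi_pmf [OF assms(1)]
      by (rule prob_space.indep_vars_compose2) simp
  qed (fact assms(1))
  also have "\<dots> = (\<Prod>i\<in>I. measure_pmf.expectation (D i) (\<phi> i))"
  proof (rule prod.cong [OF refl])
    fix i assume "i \<in> I"
    then have "D i = map_pmf (\<lambda>p. p i) (Pi_pmf I d D)"
      using assms(1) by (simp add: Pi_pmf_component)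
    then show "measure_pmf.expectation (Pi_pmf I d D) (\<lambda>p. \<phi> i (p i)) =
        measure_pmf.expectation (D i) (\<phi> i)"
      by (simp only: integral_map_pmf)
  qed
  finally show ?thesis .
qed

text \<open>Independence factorizes the expectation over voters. A voter in both sets contributes
  \<rho>, a voter in neither contributes 1, and a voter in exactly one contributes a mean spin,
  which is 0; so distinct sets are orthogonal.\<close>

lemma expectation_walsh_walsh:
  fixes D :: "'a pmf" and u v :: "'a \<Rightarrow> bool"
  assumes D: "finite (set_pmf D)"
    and u: "measure_pmf.expectation D (\<lambda>a. spin (u a)) = 0"
    and v: "measure_pmf.expectation D (\<lambda>a. spin (v a)) = 0"
    and uv: "measure_pmf.expectation D (\<lambda>a. spin (u a) * spin (v a)) = \<rho>"
    and S: "S \<subseteq> {1..n}" and T: "T \<subseteq> {1..n}"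
  shows "measure_pmf.expectation (Pi_pmf {1..n} d (\<lambda>_. D))
           (\<lambda>p. walsh S (\<lambda>i\<in>{1..n}. u (p i)) * walsh T (\<lambda>i\<in>{1..n}. v (p i))) =
         (if S = T then \<rho> ^ card S else 0)"
proof -
  \<comment> \<open>Padding with factors 1 lets both Walsh functions become products over all
    voters, as independence requires.\<close>
  define \<phi> where "\<phi> i a = (if i \<in> S then spin (u a) else 1) * (if i \<in> T then spin (v a) else 1)" for i a
  have eq: "walsh S (\<lambda>i\<in>{1..n}. u (p i)) = (\<Prod>i\<in>{1..n}. if i \<in> S then spin (u (p i)) else 1)"
    if "S \<subseteq> {1..n}" for S and u :: "'a \<Rightarrow> bool" and p
  proof -
    have "(\<Prod>i\<in>{1..n}. if i \<in> S then spin (u (p i)) else 1) = (\<Prod>i\<in>{1..n} \<inter> S. spin (u (p i)))"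
      by (rule prod.inter_restrict [symmetric]) simp
    also have "{1..n} \<inter> S = S"
      using that by blast
    finally show ?thesis
      unfolding walsh_def using that by (auto intro!: prod.cong)
  qed
  have "measure_pmf.expectation (Pi_pmf {1..n} d (\<lambda>_. D))
           (\<lambda>p. walsh S (\<lambda>i\<in>{1..n}. u (p i)) * walsh T (\<lambda>i\<in>{1..n}. v (p i))) =
        measure_pmf.expectation (Pi_pmf {1..n} d (\<lambda>_. D)) (\<lambda>p. \<Prod>i\<in>{1..n}. \<phi> i (p i))"
    unfolding eq [OF S] eq [OF T] \<phi>_def prod.distrib ..
  also have "\<dots> = (\<Prod>i\<in>{1..n}. measure_pmf.expectation D (\<phi> i))"
    using D by (intro expectation_prod_Pi_pmf_real) simp_all
  also have "\<dots> = (\<Prod>i\<in>{1..n}. if i \<in> S \<and> i \<in> T then \<rho> else if i \<in> S \<or> i \<in> T then 0 else 1)"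
    by (rule prod.cong [OF refl]) (auto simp: \<phi>_def [abs_def] u v uv)
  also have "\<dots> = (if S = T then \<rho> ^ card S else 0)"
  proof (cases "S = T")
    case True
    have "(\<Prod>i\<in>{1..n}. if i \<in> S then \<rho> else 1) = (\<Prod>i\<in>{1..n} \<inter> S. \<rho>)"
      by (rule prod.inter_restrict [symmetric]) simp
    moreover have "{1..n} \<inter> S = S"
      using S by blast
    moreover have "(\<Prod>i\<in>{1..n}. if i \<in> S \<and> i \<in> T then \<rho> else if i \<in> S \<or> i \<in> T then 0 else 1) =
        (\<Prod>i\<in>{1..n}. if i \<in> S then \<rho> else 1)"
      using True by (intro prod.cong) auto
    ultimately show ?thesis
      using True by simp
  next
    case False
    then obtain i where "i \<in> S \<and> i \<notin> T \<or> i \<in> T \<and> i \<notin> S"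
      by blast
    then show ?thesis
      using False S T by (auto intro!: prod_zero bexI [of _ i])
  qed
  finally show ?thesis .
qed

lemma expectation_choice:
  fixes D :: "'a pmf" and u :: "'a \<Rightarrow> bool"
  assumes D: "finite (set_pmf D)"
    and u: "measure_pmf.expectation D (\<lambda>a. spin (u a)) = 0"
  shows "measure_pmf.expectation (Pi_pmf {1..n} d (\<lambda>_. D)) (\<lambda>p. of_bool (f (\<lambda>i\<in>{1..n}. u (p i)))) =
         fourier_coeff n f {}"
proof -
  let ?P = "Pi_pmf {1..n} d (\<lambda>_. D)"
  have int: "integrable (measure_pmf ?P) \<psi>" for \<psi> :: "_ \<Rightarrow> real"
    using D by (intro integrable_measure_pmf_finite) (simp add: set_Pi_pmf finite_PiE_dflt)
  \<comment> \<open>The factor \<open>walsh {}\<close> is the constant 1; it makes each term an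
    instance of the orthogonality relation with \<open>T = {}\<close>.\<close>
  have "measure_pmf.expectation ?P (\<lambda>p. of_bool (f (\<lambda>i\<in>{1..n}. u (p i)))) =
      (\<Sum>S\<in>Pow {1..n}. fourier_coeff n f S *
         measure_pmf.expectation ?P (\<lambda>p. walsh S (\<lambda>i\<in>{1..n}. u (p i)) * walsh {} (\<lambda>i\<in>{1..n}. u (p i))))"
    unfolding walsh_expansion_restrict [of f _ n]
    by (simp add: int walsh_def [of "{}"])
  also have "\<dots> = (\<Sum>S\<in>Pow {1..n}. if S = {} then fourier_coeff n f S else 0)"
    by (intro sum.cong refl) (simp add: expectation_walsh_walsh [OF D u u refl])
  also have "\<dots> = fourier_coeff n f {}"
    by (simp add: sum.delta)
  finally show ?thesis .
qed

text \<open>A Parseval formula for correlated inputs: orthogonality collapses the double Walsh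
  expansion to its diagonal. For \<open>u = v\<close> and \<rho> = 1 it is the ordinary Parseval
  identity.\<close>

lemma expectation_choice_choice:
  fixes D :: "'a pmf" and u v :: "'a \<Rightarrow> bool"
  assumes D: "finite (set_pmf D)"
    and u: "measure_pmf.expectation D (\<lambda>a. spin (u a)) = 0"
    and v: "measure_pmf.expectation D (\<lambda>a. spin (v a)) = 0"
    and uv: "measure_pmf.expectation D (\<lambda>a. spin (u a) * spin (v a)) = \<rho>"
  shows "measure_pmf.expectation (Pi_pmf {1..n} d (\<lambda>_. D))
           (\<lambda>p. of_bool (f (\<lambda>i\<in>{1..n}. u (p i))) * of_bool (g (\<lambda>i\<in>{1..n}. v (p i)))) =
         (\<Sum>S\<in>Pow {1..n}. fourier_coeff n f S * fourier_coeff n g S * \<rho> ^ card S)"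
proof -
  let ?P = "Pi_pmf {1..n} d (\<lambda>_. D)"
  let ?x = "\<lambda>p. \<lambda>i\<in>{1..n}. u (p i)" and ?y = "\<lambda>p. \<lambda>i\<in>{1..n}. v (p i)"
  have int: "integrable (measure_pmf ?P) \<psi>" for \<psi> :: "_ \<Rightarrow> real"
    using D by (intro integrable_measure_pmf_finite) (simp add: set_Pi_pmf finite_PiE_dflt)
  have "of_bool (f (?x p)) * of_bool (g (?y p)) =
      (\<Sum>S\<in>Pow {1..n}. \<Sum>T\<in>Pow {1..n}. fourier_coeff n f S * fourier_coeff n g T *
         (walsh S (?x p) * walsh T (?y p)))" for p
    unfolding walsh_expansion_restrict [of f "\<lambda>i. u (p i)" n]
      walsh_expansion_restrict [of g "\<lambda>i. v (p i)" n] sum_product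
    by (simp add: mult_ac)
  then have "measure_pmf.expectation ?P (\<lambda>p. of_bool (f (?x p)) * of_bool (g (?y p))) =
      (\<Sum>S\<in>Pow {1..n}. \<Sum>T\<in>Pow {1..n}. fourier_coeff n f S * fourier_coeff n g T *
         measure_pmf.expectation ?P (\<lambda>p. walsh S (?x p) * walsh T (?y p)))"
    by (simp add: int)
  also have "\<dots> = (\<Sum>S\<in>Pow {1..n}. \<Sum>T\<in>Pow {1..n}.
      if T = S then fourier_coeff n f S * fourier_coeff n g T * \<rho> ^ card S else 0)"
    by (intro sum.cong refl) (auto simp add: expectation_walsh_walsh [OF D u v uv])
  also have "\<dots> = (\<Sum>S\<in>Pow {1..n}. fourier_coeff n f S * fourier_coeff n g S * \<rho> ^ card S)"
    by (intro sum.cong refl) (simp add: sum.delta)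
  finally show ?thesis .
qed

section \<open>Power sums of the correlations\<close>

text \<open>Since \<open>a \<le> p\<close> and \<open>a \<le> q\<close>, the step from \<open>m\<close> to \<open>m + 2\<close> reduces to
  \<open>1 - a\<^sup>2 \<le> (1 - p\<^sup>2) + (1 - q\<^sup>2)\<close>, that is, to \<open>(1 - p) (1 - q) \<ge> 0\<close>.\<close>

lemma odd_power_defect_mono:
  fixes p q a :: real
  assumes "0 \<le> a" "p \<le> 1" "q \<le> 1" "p + q = 1 + a"
  shows "1 + a ^ 3 - p ^ 3 - q ^ 3 \<le> 1 + a ^ (2 * j + 3) - p ^ (2 * j + 3) - q ^ (2 * j + 3)"
proof (induction j)
  case (Suc j)
  define m where "m = 2 * j + 3"
  have ap: "a \<le> p" "a \<le> q"
    using assms by linarith+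
  have "0 \<le> (1 - p) * (1 - q)"
    using assms by simp
  then have "p * q \<ge> a"
    using assms(4) by (simp add: algebra_simps)
  moreover have "(p + q)\<^sup>2 = (1 + a)\<^sup>2"
    using assms(4) by simp
  ultimately have sq: "1 - a\<^sup>2 \<le> (1 - p\<^sup>2) + (1 - q\<^sup>2)"
    by (simp add: power2_eq_square algebra_simps)
  have p1: "1 - p\<^sup>2 \<ge> 0" "1 - q\<^sup>2 \<ge> 0"
    using assms ap by (simp_all add: power_le_one)
  have "a ^ m * (1 - a\<^sup>2) \<le> a ^ m * (1 - p\<^sup>2) + a ^ m * (1 - q\<^sup>2)"
    using mult_left_mono [OF sq, of "a ^ m"] assms(1) by (simp only: distrib_left zero_le_power)
  also have "\<dots> \<le> p ^ m * (1 - p\<^sup>2) + q ^ m * (1 - q\<^sup>2)"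
    using ap assms p1 by (intro add_mono mult_right_mono power_mono) auto
  finally have "a ^ m - p ^ m - q ^ m \<le> a ^ (m + 2) - p ^ (m + 2) - q ^ (m + 2)"
    by (simp add: power_add power2_eq_square algebra_simps)
  then show ?case
    using Suc by (simp add: m_def add.commute)
qed simp

text \<open>If one of the numbers, say \<open>a\<close>, is nonnegative, then \<open>p = -b\<close>
  and \<open>q = -c\<close> satisfy \<open>p + q = 1 + a\<close>, and oddness turns the previous
  lemma into the claim. If all are nonpositive, each odd power increases with the exponent
  separately.\<close>

lemma odd_power_sum_mono:
  fixes a b c :: real
  assumes "\<bar>a\<bar> \<le> 1" "\<bar>b\<bar> \<le> 1" "\<bar>c\<bar> \<le> 1" "a + b + c = -1" "odd k" "k \<ge> 3"
  shows "a ^ 3 + b ^ 3 + c ^ 3 \<le> a ^ k + b ^ k + c ^ k"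
proof -
  have "k = 2 * ((k - 3) div 2) + 3"
    using assms(5,6) by presburger
  then obtain j where k: "k = 2 * j + 3" ..
  have pos: "a ^ 3 + b ^ 3 + c ^ 3 \<le> a ^ k + b ^ k + c ^ k"
    if "a \<ge> 0" "\<bar>b\<bar> \<le> 1" "\<bar>c\<bar> \<le> 1" "a + b + c = -1" for a b c :: real
    using odd_power_defect_mono [of a "-b" "-c" j] that
    by (simp add: k)
  have nonpos: "x ^ 3 \<le> x ^ k" if "x \<le> 0" "\<bar>x\<bar> \<le> 1" for x :: real
  proof -
    have "(-x) ^ k \<le> (-x) ^ 3"
      using that assms(6) by (intro power_decreasing) auto
    then show ?thesis
      using assms(5) by simp
  qed
  consider "a \<ge> 0" | "b \<ge> 0" | "c \<ge> 0" | "a \<le> 0" "b \<le> 0" "c \<le> 0"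
    by linarith
  then show ?thesis
  proof cases
    case 1 then show ?thesis using pos [of a b c] assms by simp
  next
    case 2 then show ?thesis using pos [of b a c] assms by (simp add: algebra_simps)
  next
    case 3 then show ?thesis using pos [of c a b] assms by (simp add: algebra_simps)
  next
    case 4 then show ?thesis using nonpos [of a] nonpos [of b] nonpos [of c] assms by simp
  qed
qed

text \<open>For a + b + c = -1 the cube of the sum gives
  \<open>1 + a^3 + b^3 + c^3 = 3 * (1 + a) * (1 + b) * (1 + c)\<close>, where 1 + a = 4\<alpha> and
  likewise for the others. This form exhibits the sign of the factor.\<close>

lemma cubic_defect_eq:
  fixes \<alpha> \<beta> \<gamma> :: real
  assumes "\<alpha> + \<beta> + \<gamma> = 1/2"
  shows "1 + (4*\<alpha> - 1)^3 + (4*\<beta> - 1)^3 + (4*\<gamma> - 1)^3 = 192 * \<alpha> * \<beta> * \<gamma>"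
proof -
  have \<gamma>: "\<gamma> = 1/2 - \<alpha> - \<beta>"
    using assms by simp
  show ?thesis
    unfolding \<gamma> by (simp add: field_simps power3_eq_cube)
qed

text \<open>The inequality of arithmetic and geometric means bounds the product of the weights by
  1/216, which would even give 8/9. The bound 1 says that the sum of the cubed correlations is at
  most 0.\<close>

lemma product_le_of_sum_half:
  fixes \<alpha> \<beta> \<gamma> :: real
  assumes "\<alpha> \<ge> 0" "\<beta> \<ge> 0" "\<gamma> \<ge> 0" "\<alpha> + \<beta> + \<gamma> = 1/2"
  shows "192 * \<alpha> * \<beta> * \<gamma> \<le> 1"
proof -
  have "4 * (\<alpha> * \<beta>) \<le> (\<alpha> + \<beta>)\<^sup>2"
    using sum_squares_bound[of \<alpha> \<beta>] by (simp add: power2_eq_square algebra_simps)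
  then have "4 * (\<alpha> * \<beta>) * \<gamma> \<le> (\<alpha> + \<beta>)\<^sup>2 * \<gamma>"
    using assms by (intro mult_right_mono)
  moreover have "(\<alpha> + \<beta>)\<^sup>2 * (2 * \<gamma>) \<le> 1 / 27"
  proof -
    define t where "t = \<alpha> + \<beta>"
    have g: "2 * \<gamma> = 1 - 2 * t" using assms by (simp add: t_def)
    \<comment> \<open>The maximum of \<open>t^2 * (1 - 2 * t)\<close> for \<open>t \<ge> 0\<close>
      is attained at 1/3, hence the double root there.\<close>
    have "1/27 - t\<^sup>2 * (1 - 2 * t) = (t - 1/3)\<^sup>2 * (2 * t + 1/3)"
      by (simp add: power2_eq_square field_simps)
    moreover have "t \<ge> 0" using assms by (simp add: t_def)
    then have "(t - 1/3)\<^sup>2 * (2 * t + 1/3) \<ge> 0" by simp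
    ultimately show ?thesis unfolding g t_def[symmetric] by linarith
  qed
  ultimately show ?thesis
    by (simp add: mult_ac)
qed

text \<open>For even \<open>k\<close> the two sides are separated by 0; odd \<open>k\<close>, which
  is then at least 3, falls under \<open>odd_power_sum_mono\<close>.\<close>

lemma power_sum_ge_cubic:
  fixes \<alpha> \<beta> \<gamma> :: real
  assumes "\<alpha> \<ge> 0" "\<beta> \<ge> 0" "\<gamma> \<ge> 0" "\<alpha> + \<beta> + \<gamma> = 1/2" "k \<ge> 2"
  shows "(4*\<alpha> - 1)^3 + (4*\<beta> - 1)^3 + (4*\<gamma> - 1)^3 \<le> (4*\<alpha> - 1)^k + (4*\<beta> - 1)^k + (4*\<gamma> - 1)^k"
proof (cases "even k")
  case True
  have "(4*\<alpha> - 1)^3 + (4*\<beta> - 1)^3 + (4*\<gamma> - 1)^3 \<le> 0"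
    using cubic_defect_eq [OF assms(4)] product_le_of_sum_half [OF assms(1-4)] by linarith
  also have "0 \<le> (4*\<alpha> - 1)^k + (4*\<beta> - 1)^k + (4*\<gamma> - 1)^k"
    using True by (intro add_nonneg_nonneg zero_le_even_power)
  finally show ?thesis .
next
  case False
  have "k \<noteq> 2"
    using False by auto
  then show ?thesis
    using assms False by (intro odd_power_sum_mono) auto
qed

section \<open>The majority function\<close>

text \<open>The probability of a tie among \<open>2 * k\<close> independent fair votes.\<close>

definition central_ratio :: "nat \<Rightarrow> real" where
  "central_ratio k = of_nat ((2 * k) choose k) / 4 ^ k"

lemma central_ratio_Suc: "central_ratio (Suc k) = central_ratio k * (2 * k + 1) / (2 * k + 2)"
proof -
  \<comment> \<open>Two absorption identities lead from \<open>(2 * k + 2) choose Suc k\<close>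
    through \<open>(2 * k + 1) choose k\<close> down to \<open>(2 * k) choose k\<close>.\<close>
  have "real (Suc k * ((2 * k + 2) choose Suc k)) = real ((2 * k + 2) * ((2 * k + 1) choose k))"
    using Suc_times_binomial_eq [of "2 * k + 1" k] by (intro arg_cong [of _ _ real]) simp
  then have "(real k + 1) * real ((2 * k + 2) choose Suc k) = (real k + 1) * (2 * real ((2 * k + 1) choose k))"
    by (simp add: algebra_simps del: binomial_Suc_Suc)
  then have "real ((2 * k + 2) choose Suc k) = 2 * real ((2 * k + 1) choose k)"
    by (subst (asm) mult_cancel_left) auto
  moreover have "real ((k + 1) * ((2 * k + 1) choose k)) = real ((2 * k + 1) * ((2 * k) choose k))"
    using binomial_absorb_comp [of "2 * k + 1" k] by (intro arg_cong [of _ _ real]) simp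
  then have "(real k + 1) * real ((2 * k + 1) choose k) = (2 * real k + 1) * real ((2 * k) choose k)"
    by (simp add: algebra_simps del: binomial_Suc_Suc)
  ultimately have "(real k + 1) * real ((2 * Suc k) choose Suc k) = 2 * (2 * real k + 1) * real ((2 * k) choose k)"
    by (simp add: algebra_simps del: binomial_Suc_Suc)
  then show ?thesis
    unfolding central_ratio_def
    by (simp add: divide_simps del: binomial_Suc_Suc) (simp add: algebra_simps del: binomial_Suc_Suc)
qed

text \<open>The recursion for \<open>central_ratio\<close> multiplies
  \<open>(2 * k + 1) * (central_ratio k)^2\<close> by exactly the reciprocal of the next Wallis
  factor. The identity transfers Wallis' limit to central binomial coefficients.\<close>

lemma wallis_central_ratio:
  "(2 * real k + 1) * (central_ratio k)\<^sup>2 * (\<Prod>j=1..k. (4*real j^2) / (4*real j^2 - 1)) = 1"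
proof (induction k)
  case (Suc k)
  define w where "w = (\<Prod>j=1..k. (4*real j^2) / (4*real j^2 - 1))"
  define r where "r = central_ratio k"
  have IH: "(2 * real k + 1) * r\<^sup>2 * w = 1" using Suc unfolding w_def r_def .
  have f: "(4*real (Suc k)^2) / (4*real (Suc k)^2 - 1) = (2 * real k + 2)\<^sup>2 / ((2 * real k + 1) * (2 * real k + 3))"
    by (simp add: power2_eq_square algebra_simps)
  have "(2 * real (Suc k) + 1) * (central_ratio (Suc k))\<^sup>2 * (\<Prod>j=1..Suc k. (4*real j^2) / (4*real j^2 - 1))
    = (2 * real k + 3) * (r * (2 * real k + 1) / (2 * real k + 2))\<^sup>2 *
      (w * ((2 * real k + 2)\<^sup>2 / ((2 * real k + 1) * (2 * real k + 3))))"
    using f by (simp add: w_def r_def central_ratio_Suc algebra_simps)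
  also have "\<dots> = (2 * real k + 1) * r\<^sup>2 * w"
  proof -
    have "C * (r * A / B)\<^sup>2 * (w * (B\<^sup>2 / (A * C))) = A * r\<^sup>2 * w"
      if "A \<noteq> 0" "B \<noteq> 0" "C \<noteq> 0" for A B C :: real
      using that by (simp add: field_simps power2_eq_square)
    then show ?thesis
      by this (simp_all add: add_nonneg_eq_0_iff)
  qed
  finally show ?case using IH by (simp only:)
qed (simp add: central_ratio_def)

section \<open>First-level coefficients of the majority function\<close>

lemma sum_cube_split:
  fixes \<phi> :: "(nat \<Rightarrow> bool) \<Rightarrow> real"
  assumes "i \<in> {1..n}"
  shows "(\<Sum>x\<in>cube n. \<phi> x) =
    (\<Sum>y\<in>{1..n} - {i} \<rightarrow>\<^sub>E UNIV. \<phi> (y(i := True)) + \<phi> (y(i := False)))"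
proof -
  let ?A = "{1..n} - {i}"
  have "cube n = insert i ?A \<rightarrow>\<^sub>E UNIV"
    using assms by (simp add: cube_def insert_absorb)
  then have "cube n = (\<lambda>(b, y). y(i := b)) ` (UNIV \<times> (?A \<rightarrow>\<^sub>E UNIV))"
    by (simp only: PiE_insert_eq)
  then have "(\<Sum>x\<in>cube n. \<phi> x) = (\<Sum>(b, y)\<in>UNIV \<times> (?A \<rightarrow>\<^sub>E UNIV). \<phi> (y(i := b)))"
    using sum.reindex [OF inj_combinator [of i ?A "\<lambda>_. UNIV"], of \<phi>]
    by (simp add: case_prod_unfold o_def)
  also have "\<dots> = (\<Sum>b\<in>UNIV. \<Sum>y\<in>?A \<rightarrow>\<^sub>E UNIV. \<phi> (y(i := b)))"
    by (simp add: sum.cartesian_product)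
  also have "\<dots> = (\<Sum>y\<in>?A \<rightarrow>\<^sub>E UNIV. \<phi> (y(i := True)) + \<phi> (y(i := False)))"
    by (simp add: UNIV_bool sum.distrib add.commute)
  finally show ?thesis .
qed

lemma card_boolean_vectors:
  assumes "finite A"
  shows "card {y \<in> A \<rightarrow>\<^sub>E (UNIV :: bool set). card {j\<in>A. y j} = k} = card A choose k"
proof -
  have "bij_betw (\<lambda>y. {j\<in>A. y j}) {y \<in> A \<rightarrow>\<^sub>E (UNIV :: bool set). card {j\<in>A. y j} = k}
      {B. B \<subseteq> A \<and> card B = k}"
  proof (rule bij_betw_byWitness [where f' = "\<lambda>B. \<lambda>j\<in>A. j \<in> B"])
    show "(\<lambda>B. \<lambda>j\<in>A. j \<in> B) ` {B. B \<subseteq> A \<and> card B = k}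
        \<subseteq> {y \<in> A \<rightarrow>\<^sub>E UNIV. card {j\<in>A. y j} = k}"
    proof safe
      fix B assume "B \<subseteq> A" "k = card B"
      moreover have "{j\<in>A. (\<lambda>j\<in>A. j \<in> B) j} = B"
        using \<open>B \<subseteq> A\<close> by auto
      ultimately show "card {j\<in>A. (\<lambda>j\<in>A. j \<in> B) j} = card B"
        by simp
    qed auto
  qed (auto simp: PiE_def extensional_def restrict_def)
  from bij_betw_same_card [OF this] show ?thesis
    by (simp add: n_subsets [OF assms])
qed

text \<open>Voter \<open>i\<close> is pivotal for the majority exactly when \<open>n div 2\<close> of the other voters
  vote \<open>True\<close>.\<close>

lemma fourier_coeff_majority_singleton:
  assumes i: "i \<in> {1..n}"
  shows "fourier_coeff n (majority n) {i} = ((n - 1) choose (n div 2)) / 2 ^ n"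
proof -
  let ?A = "{1..n} - {i}"
  \<comment> \<open>Rounding down serves both parities: for even \<open>n\<close> a tie is not a
    majority.\<close>
  have half: "real k > real n / 2 \<longleftrightarrow> n div 2 < k" for k
    by linarith
  have pivot: "of_bool (majority n (y(i := True))) * walsh {i} (y(i := True)) +
      of_bool (majority n (y(i := False))) * walsh {i} (y(i := False)) =
      of_bool (card {j\<in>?A. y j} = n div 2)" for y
  proof -
    have "{j\<in>{1..n}. (y(i := True)) j} = insert i {j\<in>?A. y j}"
         "{j\<in>{1..n}. (y(i := False)) j} = {j\<in>?A. y j}"
      using i by auto
    then have "card {j\<in>{1..n}. (y(i := True)) j} = Suc (card {j\<in>?A. y j})"
      and "card {j\<in>{1..n}. (y(i := False)) j} = card {j\<in>?A. y j}"
      by simp_all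
    then have "majority n (y(i := True)) \<longleftrightarrow> n div 2 \<le> card {j\<in>?A. y j}"
      and "majority n (y(i := False)) \<longleftrightarrow> n div 2 < card {j\<in>?A. y j}"
      by (simp_all only: majority_def half less_Suc_eq_le)
    then show ?thesis
      by (auto simp: walsh_def)
  qed
  have "(\<Sum>x\<in>cube n. of_bool (majority n x) * walsh {i} x) =
      (\<Sum>y\<in>?A \<rightarrow>\<^sub>E UNIV. of_bool (card {j\<in>?A. y j} = n div 2))"
    by (simp only: sum_cube_split [OF i] pivot)
  also have "\<dots> = card {y \<in> ?A \<rightarrow>\<^sub>E UNIV. card {j\<in>?A. y j} = n div 2}"
    by (simp add: finite_PiE Int_def)
  also have "\<dots> = card ?A choose (n div 2)"
    by (subst card_boolean_vectors) simp_all
  also have "card ?A = n - 1"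
    using i by simp
  finally show ?thesis
    by (simp add: fourier_coeff_walsh)
qed

text \<open>For odd \<open>n\<close> the other voters number \<open>2 * k\<close>, and the claim is
  immediate. For \<open>n = 2 * k\<close>, Pascal's rule splits the central coefficient into two
  terms that are equal by symmetry.\<close>

lemma binomial_eq_half_central_ratio:
  assumes "n \<ge> 1"
  shows "((n - 1) choose (n div 2)) / 2 ^ n = central_ratio (n div 2) / 2"
proof (cases "even n")
  case True
  then obtain k where n: "n = 2 * k" ..
  then obtain m where k: "k = Suc m"
    using assms by (cases k) auto
  have "2 * k = Suc (2 * m + 1)" "n - 1 = 2 * m + 1"
    by (simp_all add: n k)
  moreover have "(2 * m + 1) choose m = (2 * m + 1) choose Suc m"
    using binomial_symmetric [of m "2 * m + 1"] by (simp add: Suc_eq_plus1)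
  ultimately have "real ((2 * k) choose k) = 2 * real ((n - 1) choose k)"
    unfolding k by (simp only: binomial_Suc_Suc of_nat_add mult_2)
  then show ?thesis
    by (simp add: n central_ratio_def power_mult)
next
  case False
  then obtain k where "n = 2 * k + 1" ..
  then show ?thesis
    by (simp add: central_ratio_def power_mult power_add)
qed

lemma d_m_eq: "d_m n = n * (central_ratio (n div 2))\<^sup>2 / 4"
proof (cases "n = 0")
  case False
  have "d_m n = (\<Sum>i=1..n. (central_ratio (n div 2) / 2)\<^sup>2)"
    unfolding d_m_def
  proof (intro sum.cong refl)
    fix i assume "i \<in> {1..n}"
    then show "(fourier_coeff n (majority n) {i})\<^sup>2 = (central_ratio (n div 2) / 2)\<^sup>2"
      using False by (simp add: fourier_coeff_majority_singleton binomial_eq_half_central_ratio)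
  qed
  then show ?thesis
    by (simp add: power_divide)
qed (simp add: d_m_def)

section \<open>Upper bound and limit of \<open>d_m\<close>\<close>

lemma central_ratio_bound: "k \<ge> 1 \<Longrightarrow> (2 * real k + 1) * (central_ratio k)\<^sup>2 \<le> 3 / 4"
proof (induction k rule: nat_induct_at_least)
  case base
  show ?case
    by (simp add: central_ratio_def power2_eq_square choose_one)
next
  case (Suc k)
  \<comment> \<open>The bounded sequence is decreasing: the quotient of consecutive terms has this
    numerator and denominator. Its value at \<open>k = 1\<close> is the bound 3/4.\<close>
  have "(2 * real k + 3) * (2 * real k + 1) \<le> (2 * real k + 2)\<^sup>2"
    by (simp add: power2_eq_square algebra_simps)
  then have "(2 * real k + 3) * (2 * real k + 1) / (2 * real k + 2)\<^sup>2 \<le> 1"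
    by (simp add: divide_le_eq_1)
  then have "(2 * real k + 1) * (central_ratio k)\<^sup>2 * ((2 * real k + 3) * (2 * real k + 1) / (2 * real k + 2)\<^sup>2)
      \<le> (2 * real k + 1) * (central_ratio k)\<^sup>2"
    by (intro mult_right_le_one_le) auto
  moreover have "(2 * real (Suc k) + 1) * (central_ratio (Suc k))\<^sup>2 =
      (2 * real k + 1) * (central_ratio k)\<^sup>2 * ((2 * real k + 3) * (2 * real k + 1) / (2 * real k + 2)\<^sup>2)"
    by (simp add: central_ratio_Suc power2_eq_square algebra_simps)
  ultimately show ?case
    using Suc.IH by linarith
qed

text \<open>Two voters are the least number for which \<open>n div 2\<close> reaches 1; for a single
  voter \<open>d_m\<close> equals 1/4 and there is no gap.\<close>

lemma d_m_le:
  assumes "n \<ge> 2"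
  shows "d_m n \<le> 3 / 16"
proof -
  have "real n \<le> 2 * real (n div 2) + 1"
    by linarith
  then have "real n * (central_ratio (n div 2))\<^sup>2 \<le> (2 * real (n div 2) + 1) * (central_ratio (n div 2))\<^sup>2"
    by (rule mult_right_mono) simp
  also have "\<dots> \<le> 3 / 4"
    using assms by (intro central_ratio_bound) simp
  finally show ?thesis
    by (simp add: d_m_eq)
qed

text \<open>With \<open>k = n div 2\<close>, \<open>d_m n\<close> is a quarter of
  \<open>n / (2 * k + 1)\<close> times \<open>w k\<close>. The first factor is squeezed to 1, and
  the second tends to 2 / \<pi> as a reciprocal Wallis product.\<close>

lemma d_m_tendsto: "d_m \<longlonglongrightarrow> 1 / (2 * pi)"
proof -
  define w where "w k = (2 * real k + 1) * (central_ratio k)\<^sup>2" for k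
  have "w = (\<lambda>k. inverse (\<Prod>j=1..k. (4*real j^2) / (4*real j^2 - 1)))"
    unfolding w_def by (rule ext, rule inverse_unique [symmetric])
      (simp only: mult.commute [of "prod _ _"] wallis_central_ratio)
  then have "w \<longlonglongrightarrow> inverse (pi / 2)"
    using tendsto_inverse [OF wallis] by simp
  moreover have "filterlim (\<lambda>n::nat. n div 2) at_top at_top"
    by (rule filterlim_at_top_div_const_nat) simp
  ultimately have w: "(\<lambda>n. w (n div 2)) \<longlonglongrightarrow> inverse (pi / 2)"
    by (rule filterlim_compose)
  have "(\<lambda>n. real n / (2 * real (n div 2) + 1)) \<longlonglongrightarrow> 1"
  proof (rule tendsto_sandwich)
    show "(\<lambda>n. real n / real (Suc n)) \<longlonglongrightarrow> 1"
      by (rule LIMSEQ_n_over_Suc_n)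
    show "(\<lambda>_. 1 :: real) \<longlonglongrightarrow> 1"
      by simp
    have "real n / real (Suc n) \<le> real n / (2 * real (n div 2) + 1)" for n
      by (intro divide_left_mono) (linarith | simp)+
    then show "\<forall>\<^sub>F n in sequentially. real n / real (Suc n) \<le> real n / (2 * real (n div 2) + 1)"
      by simp
    have "real n / (2 * real (n div 2) + 1) \<le> 1" for n
      by (subst divide_le_eq_1_pos) linarith+
    then show "\<forall>\<^sub>F n in sequentially. real n / (2 * real (n div 2) + 1) \<le> 1"
      by simp
  qed
  from tendsto_divide [OF tendsto_mult [OF this w] tendsto_const [of 4]]
  have "(\<lambda>n. real n / (2 * real (n div 2) + 1) * w (n div 2) / 4) \<longlonglongrightarrow> 1 / (2 * pi)"
    by (simp add: field_simps)
  moreover have "real n / (2 * real (n div 2) + 1) * w (n div 2) / 4 = d_m n" for n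
  proof -
    have "2 * real (n div 2) + 1 \<noteq> 0"
      by linarith
    then show ?thesis
      unfolding w_def d_m_eq by simp
  qed
  ultimately show ?thesis
    by simp
qed

section \<open>Majority maximizes the first-level weight\<close>

lemma fourier_coeff_level_one_sum:
  "(\<Sum>i=1..n. fourier_coeff n f {i}) = (\<Sum>x\<in>cube n. of_bool (f x) * (\<Sum>i=1..n. spin (x i))) / 2 ^ n"
  unfolding fourier_coeff_walsh walsh_def sum_divide_distrib [symmetric] sum_distrib_left
  by (subst sum.swap) simp

lemma majority_iff_spin_sum: "majority n x \<longleftrightarrow> (\<Sum>i=1..n. spin (x i)) > 0"
proof -
  have "(\<Sum>i=1..n. spin (x i)) = 2 * (\<Sum>i=1..n. of_bool (x i)) - real n"
    by (simp add: spin_def sum_subtractf sum_distrib_left)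
  also have "(\<Sum>i=1..n. of_bool (x i)) = real (card {i\<in>{1..n}. x i})"
    by (simp add: Int_def)
  finally show ?thesis
    unfolding majority_def by linarith
qed

text \<open>With equal coefficients \<open>c\<close> the weight is \<open>n * c^2\<close>, and
  \<open>n * c\<close> is the average of \<open>f x * L x\<close>. The majority selects exactly the
  points with \<open>L x > 0\<close>, so it maximizes this average.\<close>

lemma level_one_weight_le_d_m:
  assumes eq: "\<And>i j. i \<in> {1..n} \<Longrightarrow> j \<in> {1..n} \<Longrightarrow> fourier_coeff n f {i} = fourier_coeff n f {j}"
  shows "(\<Sum>i=1..n. (fourier_coeff n f {i})\<^sup>2) \<le> d_m n"
proof (cases "n = 0")
  case False
  define L where "L x = (\<Sum>i=1..n. spin (x i))" for x
  define c where "c = fourier_coeff n f {1}"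
  define m where "m = fourier_coeff n (majority n) {1}"
  have c: "fourier_coeff n f {i} = c" if "i \<in> {1..n}" for i
    using eq [OF that, of 1] False by (simp add: c_def)
  have m: "fourier_coeff n (majority n) {i} = m" if "i \<in> {1..n}" for i
    using that False by (simp only: m_def fourier_coeff_majority_singleton)
      (subst fourier_coeff_majority_singleton; simp)
  have "n * c = (\<Sum>x\<in>cube n. of_bool (f x) * L x) / 2 ^ n"
    using fourier_coeff_level_one_sum [of n f] by (simp add: c L_def)
  moreover have "n * m = (\<Sum>x\<in>cube n. of_bool (majority n x) * L x) / 2 ^ n"
    using fourier_coeff_level_one_sum [of n "majority n"] by (simp add: m L_def)
  moreover have "(\<Sum>x\<in>cube n. of_bool (f x) * L x) \<le> (\<Sum>x\<in>cube n. of_bool (majority n x) * L x)"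
    by (intro sum_mono) (auto simp: majority_iff_spin_sum L_def)
  \<comment> \<open>The opposite sign is needed to bound the absolute value of \<open>c\<close>.
    Since \<open>L\<close> sums to 0 over the cube, negating the sum amounts to replacing
    \<open>f\<close> by its complement.\<close>
  moreover have "- (\<Sum>x\<in>cube n. of_bool (f x) * L x) \<le> (\<Sum>x\<in>cube n. of_bool (majority n x) * L x)"
  proof -
    have "(\<Sum>x\<in>cube n. spin (x i)) = 0" if "i \<in> {1..n}" for i
      by (simp add: sum_cube_split [OF that])
    then have "(\<Sum>x\<in>cube n. L x) = 0"
      unfolding L_def by (subst sum.swap) simp
    then have "- (\<Sum>x\<in>cube n. of_bool (f x) * L x) = (\<Sum>x\<in>cube n. of_bool (\<not> f x) * L x)"
      by (simp add: of_bool_not_iff left_diff_distrib sum_subtractf)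
    also have "\<dots> \<le> (\<Sum>x\<in>cube n. of_bool (majority n x) * L x)"
      by (intro sum_mono) (auto simp: majority_iff_spin_sum L_def)
    finally show ?thesis .
  qed
  ultimately have "n * c \<le> n * m" "- (n * c) \<le> n * m"
    by (simp_all only: minus_divide_left) (simp_all only: divide_right_mono zero_le_power zero_le_numeral)
  then have "\<bar>real n * c\<bar> \<le> real n * m"
    by linarith
  then have "real n * \<bar>c\<bar> \<le> real n * m"
    by (simp add: abs_mult)
  then have "\<bar>c\<bar> \<le> m"
    using False by simp
  then have "c\<^sup>2 \<le> m\<^sup>2"
    by (metis abs_ge_zero power2_abs power_mono)
  then have "(\<Sum>i=1..n. (fourier_coeff n f {i})\<^sup>2) \<le> (\<Sum>i=1..n. m\<^sup>2)"
    by (intro sum_mono) (simp add: c)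
  also have "\<dots> = d_m n"
    unfolding d_m_def by (intro sum.cong refl) (simp add: m)
  finally show ?thesis .
qed (simp add: d_m_def)

section \<open>Neutral and symmetric social welfare functions\<close>

lemma mem_rename_iff: "bij \<sigma> \<Longrightarrow> (\<sigma> a, \<sigma> b) \<in> rename \<sigma> r \<longleftrightarrow> (a, b) \<in> r"
  unfolding rename_def by (auto simp: bij_def inj_eq intro: rev_image_eqI)

lemma strict_linear_order_rename:
  assumes "bij \<sigma>" "strict_linear_order r"
  shows "strict_linear_order (rename \<sigma> r)"
proof -
  have surj: "(\<exists>a'. a = \<sigma> a')" for a
    using assms(1) by (simp add: bij_def surj_def)
  note mem = mem_rename_iff [OF assms(1)]
  have r: "trans r" "irrefl r" "total r"
    using assms(2) by (simp_all add: strict_linear_order_on_def)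
  have "trans (rename \<sigma> r)"
  proof (rule transI)
    fix a b c assume *: "(a, b) \<in> rename \<sigma> r" "(b, c) \<in> rename \<sigma> r"
    obtain a' b' c' where "a = \<sigma> a'" "b = \<sigma> b'" "c = \<sigma> c'"
      using surj by blast
    then show "(a, c) \<in> rename \<sigma> r"
      using * r(1) by (auto simp: mem dest: transD)
  qed
  moreover have "irrefl (rename \<sigma> r)"
  proof (rule irreflI)
    fix a
    obtain a' where "a = \<sigma> a'"
      using surj by blast
    then show "(a, a) \<notin> rename \<sigma> r"
      using r(2) by (auto simp: mem irrefl_def)
  qed
  moreover have "total (rename \<sigma> r)"
  proof (rule totalI)
    fix a b :: alternative assume *: "a \<noteq> b"
    obtain a' b' where ab: "a = \<sigma> a'" "b = \<sigma> b'"
      using surj by blast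
    with * have "a' \<noteq> b'"
      by blast
    with ab show "(a, b) \<in> rename \<sigma> r \<or> (b, a) \<in> rename \<sigma> r"
      using r(3) by (simp add: mem total_on_def)
  qed
  ultimately show ?thesis
    by (simp add: strict_linear_order_on_def)
qed

lemma mem_ordering_of_triple [simp]:
  "(AltA, AltB) \<in> ordering_of_triple (x, y, z) \<longleftrightarrow> x"
  "(AltB, AltC) \<in> ordering_of_triple (x, y, z) \<longleftrightarrow> y"
  "(AltC, AltA) \<in> ordering_of_triple (x, y, z) \<longleftrightarrow> z"
  by auto

text \<open>These are the orderings A > C > B and B > C > A, so either vote on A versus B extends to
  a full ordering.\<close>

lemma strict_linear_order_of_triple:
  "strict_linear_order (ordering_of_triple (x, \<not> x, \<not> x))"
  unfolding strict_linear_order_on_def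
  by (cases x) (auto simp: trans_def irrefl_def total_on_def split: if_splits, (metis alternative.exhaust)+)

text \<open>Since every vector occurs, invariances of \<open>F\<close> on profiles become identities
  for the choice functions on the whole cube.\<close>

lemma exists_profile_votes:
  assumes "x \<in> cube n"
  obtains p where "p \<in> profiles n" "votes n AltA AltB p = x"
proof
  let ?p = "\<lambda>i\<in>{1..n}. ordering_of_triple (x i, \<not> x i, \<not> x i)"
  show "?p \<in> profiles n"
    unfolding profiles_def using strict_linear_order_of_triple by (intro restrict_PiE_iff [THEN iffD2]) blast
  show "votes n AltA AltB ?p = x"
    using assms by (auto simp: votes_def cube_def restrict_def PiE_def extensional_def fun_eq_iff)
qed

section \<open>Consequences of neutrality\<close>

lemma neutral_rename:
  assumes "neutral n F" "bij \<sigma>" "p \<in> profiles n"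
  defines "q \<equiv> (\<lambda>i\<in>{1..n}. rename \<sigma> (p i))"
  shows "q \<in> profiles n" "votes n (\<sigma> a) (\<sigma> b) q = votes n a b p" "(\<sigma> a, \<sigma> b) \<in> F q \<longleftrightarrow> (a, b) \<in> F p"
proof -
  show "q \<in> profiles n"
    using assms(2,3) strict_linear_order_rename unfolding profiles_def q_def
    by (intro restrict_PiE_iff [THEN iffD2]) (auto simp: PiE_iff)
  show "votes n (\<sigma> a) (\<sigma> b) q = votes n a b p"
    unfolding votes_def q_def by (intro restrict_ext) (simp add: mem_rename_iff [OF assms(2)])
  have "F q = rename \<sigma> (F p)"
    using assms(1-3) unfolding neutral_def q_def by blast
  then show "(\<sigma> a, \<sigma> b) \<in> F q \<longleftrightarrow> (a, b) \<in> F p"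
    by (simp add: mem_rename_iff [OF assms(2)])
qed

lemma votes_swap:
  assumes "p \<in> profiles n" "a \<noteq> b"
  shows "votes n b a p = (\<lambda>i\<in>{1..n}. \<not> votes n a b p i)"
proof -
  have "(b, a) \<in> p i \<longleftrightarrow> (a, b) \<notin> p i" if "i \<in> {1..n}" for i
  proof -
    have "strict_linear_order (p i)"
      using assms(1) that by (auto simp: profiles_def)
    then have "trans (p i)" "irrefl (p i)" "total (p i)"
      by (simp_all add: strict_linear_order_on_def)
    then show ?thesis
      using assms(2) by (auto simp: irrefl_def total_on_def dest: transD)
  qed
  then show ?thesis
    unfolding votes_def by (intro restrict_ext) simp
qed

text \<open>This rotation carries the oriented pairs governed by \<open>f\<close>, \<open>g\<close>,
  \<open>h\<close> into one another in that order.\<close>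

definition cycle_alt :: "alternative \<Rightarrow> alternative" where
  "cycle_alt a = (case a of AltA \<Rightarrow> AltB | AltB \<Rightarrow> AltC | AltC \<Rightarrow> AltA)"

lemma cycle_alt_simps [simp]:
  "cycle_alt AltA = AltB" "cycle_alt AltB = AltC" "cycle_alt AltC = AltA"
  by (simp_all add: cycle_alt_def)

lemma bij_cycle_alt: "bij cycle_alt"
proof -
  have "cycle_alt (cycle_alt (cycle_alt a)) = a" for a
    by (cases a) simp_all
  then show ?thesis
    by (intro o_bij [of "cycle_alt \<circ> cycle_alt"]) (simp_all add: fun_eq_iff)
qed

text \<open>Take a profile with votes \<open>x\<close> on A versus B. One rotation of the
  alternatives moves these votes to B versus C, a second one to C versus A, and the preference of
  the society moves along.\<close>

lemma neutral_choice_functions: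
  assumes F: "gswf n F" "has_choice_functions n F f g h" "neutral n F" and x: "x \<in> cube n"
  shows "g x = f x" "h x = f x" "f (\<lambda>i\<in>{1..n}. \<not> x i) = (\<not> f x)"
proof -
  obtain p where p: "p \<in> profiles n" "votes n AltA AltB p = x"
    using exists_profile_votes [OF x] .
  have choice: "(AltA, AltB) \<in> F p \<longleftrightarrow> f (votes n AltA AltB p)"
      "(AltB, AltC) \<in> F p \<longleftrightarrow> g (votes n AltB AltC p)"
      "(AltC, AltA) \<in> F p \<longleftrightarrow> h (votes n AltC AltA p)" if "p \<in> profiles n" for p
    using F(2) that by (auto simp: has_choice_functions_def)
  define q where "q = (\<lambda>i\<in>{1..n}. rename cycle_alt (p i))"
  note q = neutral_rename [OF F(3) bij_cycle_alt p(1), folded q_def]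
  define r where "r = (\<lambda>i\<in>{1..n}. rename cycle_alt (q i))"
  note r = neutral_rename [OF F(3) bij_cycle_alt q(1), folded r_def]
  show g: "g x = f x"
    using q(2,3) [of AltA AltB] choice(1) [OF p(1)] choice(2) [OF q(1)] p(2) by simp
  show "h x = f x"
    using r(2,3) [of AltB AltC] q(2) [of AltA AltB] choice(2) [OF q(1)] choice(3) [OF r(1)] p(2) g by simp
  \<comment> \<open>Exchanging A and B complements the votes on this pair and, by asymmetry and
    totality of \<open>F p\<close>, reverses the preference of the society.\<close>
  define \<tau> where "\<tau> = Transposition.transpose AltA AltB"
  have \<tau>: "bij \<tau>" "\<tau> AltA = AltB" "\<tau> AltB = AltA"
    by (simp_all add: \<tau>_def)
  define s where "s = (\<lambda>i\<in>{1..n}. rename \<tau> (p i))"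
  note s = neutral_rename [OF F(3) \<tau>(1) p(1), folded s_def]
  have "asym (F p)" "total (F p)"
    using F(1) p(1) by (auto simp: gswf_def)
  then have "(AltB, AltA) \<in> F p \<longleftrightarrow> (AltA, AltB) \<notin> F p"
    by (auto simp: total_on_def dest: asymD)
  moreover have "votes n AltB AltA p = (\<lambda>i\<in>{1..n}. \<not> x i)"
    using votes_swap [OF p(1), of AltA AltB] p(2) by simp
  ultimately show "f (\<lambda>i\<in>{1..n}. \<not> x i) = (\<not> f x)"
    using s(2,3) [of AltB AltA] choice(1) [OF p(1)] choice(1) [OF s(1)] p(2) \<tau> by simp
qed

text \<open>Complementation is an involution of the cube that exchanges the values 0 and 1 of
  \<open>f\<close>, so \<open>f\<close> is balanced.\<close>

lemma fourier_coeff_empty_of_antisymmetric: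
  assumes "\<And>x. x \<in> cube n \<Longrightarrow> f (\<lambda>i\<in>{1..n}. \<not> x i) = (\<not> f x)"
  shows "fourier_coeff n f {} = 1 / 2"
proof -
  let ?c = "\<lambda>x. \<lambda>i\<in>{1..n}. \<not> x i"
  have inv: "?c (?c x) = x" if "x \<in> cube n" for x
    using that by (auto simp: cube_def restrict_def PiE_def extensional_def fun_eq_iff)
  have "(\<Sum>x\<in>cube n. of_bool (f x) :: real) = (\<Sum>x\<in>cube n. of_bool (f (?c x)))"
    by (rule sum.reindex_bij_witness [of _ ?c ?c]) (simp_all only: inv restrict_mem_cube)
  also have "\<dots> = (\<Sum>x\<in>cube n. 1 - of_bool (f x))"
    by (intro sum.cong refl) (simp add: assms)
  also have "\<dots> = 2 ^ n - (\<Sum>x\<in>cube n. of_bool (f x))"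
    by (simp only: sum_subtractf sum_constant card_cube) simp
  finally have "2 * (\<Sum>x\<in>cube n. of_bool (f x)) = (2 ^ n :: real)"
    by linarith
  then show ?thesis
    by (simp add: fourier_coeff_walsh walsh_def field_simps)
qed

text \<open>For \<pi> in the group with \<open>\<pi> i = j\<close>, the map
  \<open>x \<mapsto> x \<circ> \<pi>\<close> permutes the cube, preserves \<open>f\<close>, and puts
  coordinate \<open>j\<close> in position \<open>i\<close>.\<close>

lemma symmetric_level_one_eq:
  assumes F: "has_choice_functions n F f g h" "symmetric n F" and ij: "i \<in> {1..n}" "j \<in> {1..n}"
  shows "fourier_coeff n f {i} = fourier_coeff n f {j}"
proof -
  obtain G where "subgroup G (sym_group n) \<and>
      (\<forall>i\<in>{1..n}. \<forall>j\<in>{1..n}. \<exists>\<pi>\<in>G. \<pi> i = j) \<and>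
      (\<forall>\<pi>\<in>G. \<forall>p\<in>profiles n. F (p \<circ> \<pi>) = F p)"
    using F(2) unfolding symmetric_def ..
  then have G: "subgroup G (sym_group n)"
      "\<forall>i\<in>{1..n}. \<forall>j\<in>{1..n}. \<exists>\<pi>\<in>G. \<pi> i = j"
      "\<forall>\<pi>\<in>G. \<forall>p\<in>profiles n. F (p \<circ> \<pi>) = F p"
    by simp_all
  obtain \<pi> where \<pi>: "\<pi> \<in> G" "\<pi> i = j"
    using bspec [OF bspec [OF G(2) ij(1)] ij(2)] by blast
  then have perm: "\<pi> permutes {1..n}"
    using subgroup.mem_carrier [OF G(1)] by (simp add: sym_group_def)
  \<comment> \<open>The codomain is arbitrary because both profiles and Boolean vectors are
    permuted.\<close>
  have comp_PiE: "x \<circ> \<sigma> \<in> {1..n} \<rightarrow>\<^sub>E B" if "x \<in> {1..n} \<rightarrow>\<^sub>E B" "\<sigma> permutes {1..n}"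
    for x :: "nat \<Rightarrow> 'b" and B \<sigma>
    using that permutes_in_image [OF that(2)] permutes_not_in [OF that(2)]
    by (auto simp: PiE_iff extensional_def)
  have f: "f (x \<circ> \<pi>) = f x" if x: "x \<in> cube n" for x
  proof -
    obtain p where p: "p \<in> profiles n" "votes n AltA AltB p = x"
      using exists_profile_votes [OF x] .
    have "p \<circ> \<pi> \<in> profiles n"
      using p(1) perm unfolding profiles_def by (intro comp_PiE)
    moreover have "votes n AltA AltB (p \<circ> \<pi>) = x \<circ> \<pi>"
      using permutes_in_image [OF perm] by (auto simp: p(2) [symmetric] votes_def restrict_def fun_eq_iff)
    moreover have "f (votes n AltA AltB q) \<longleftrightarrow> (AltA, AltB) \<in> F q" if "q \<in> profiles n" for q
      using F(1) that by (simp add: has_choice_functions_def)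
    moreover have "F (p \<circ> \<pi>) = F p"
      using G(3) \<pi>(1) p(1) by simp
    ultimately show ?thesis
      using p by force
  qed
  have "(\<Sum>x\<in>cube n. of_bool (f x) * walsh {j} x) = (\<Sum>x\<in>cube n. of_bool (f x) * walsh {i} x)"
  proof (rule sum.reindex_bij_witness [of _ "\<lambda>x. x \<circ> inv_into UNIV \<pi>" "\<lambda>x. x \<circ> \<pi>"])
    fix x assume x: "x \<in> cube n"
    show "x \<circ> \<pi> \<in> cube n"
      using x unfolding cube_def by (rule comp_PiE [OF _ perm])
    show "x \<circ> inv_into UNIV \<pi> \<in> cube n"
      using x unfolding cube_def by (rule comp_PiE [OF _ permutes_inv [OF perm]])
    show "x \<circ> \<pi> \<circ> inv_into UNIV \<pi> = x" "x \<circ> inv_into UNIV \<pi> \<circ> \<pi> = x"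
      using permutes_inv_o [OF perm] by (simp_all add: comp_assoc)
    show "of_bool (f (x \<circ> \<pi>)) * walsh {i} (x \<circ> \<pi>) = of_bool (f x) * walsh {j} x"
      by (simp add: f [OF x] walsh_def \<pi>(2))
  qed
  then show ?thesis
    by (simp add: fourier_coeff_walsh)
qed

section \<open>The probability of an irrational choice\<close>

lemma expectation_even_triple:
  fixes \<phi> :: "bool \<times> bool \<times> bool \<Rightarrow> real"
  assumes "\<alpha> \<ge> 0" "\<beta> \<ge> 0" "\<gamma> \<ge> 0" "\<alpha> + \<beta> + \<gamma> = 1/2"
  shows "measure_pmf.expectation (even_triple_pmf \<alpha> \<beta> \<gamma>) \<phi> =
    \<alpha> * (\<phi> (True, True, False) + \<phi> (False, False, True)) +
    \<beta> * (\<phi> (False, True, True) + \<phi> (True, False, False)) +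
    \<gamma> * (\<phi> (True, False, True) + \<phi> (False, True, False))"
proof -
  have univ: "(UNIV :: (bool \<times> bool \<times> bool) set) = UNIV \<times> UNIV \<times> UNIV"
    by simp
  have "measure_pmf.expectation (even_triple_pmf \<alpha> \<beta> \<gamma>) \<phi> = (\<Sum>t\<in>UNIV. \<phi> t * even_weight \<alpha> \<beta> \<gamma> t)"
    by (subst integral_measure_pmf_real [of UNIV]) (simp_all add: pmf_even_triple_pmf [OF assms])
  then show ?thesis
    unfolding univ
    by (simp add: UNIV_bool sum.cartesian_product [symmetric] algebra_simps del: UNIV_Times_UNIV)
qed

text \<open>In \<open>f * g * h + (1 - f) * (1 - g) * (1 - h)\<close> the cubic terms cancel, so
  only means and pairwise correlations enter.\<close>

lemma irrational_prob_eq: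
  assumes D: "finite (set_pmf D)"
  shows "irrational_prob n D f g h =
    1 - measure_pmf.expectation D (\<lambda>p. of_bool (f (votes n AltA AltB p)))
      - measure_pmf.expectation D (\<lambda>p. of_bool (g (votes n AltB AltC p)))
      - measure_pmf.expectation D (\<lambda>p. of_bool (h (votes n AltC AltA p)))
      + measure_pmf.expectation D (\<lambda>p. of_bool (f (votes n AltA AltB p)) * of_bool (g (votes n AltB AltC p)))
      + measure_pmf.expectation D (\<lambda>p. of_bool (g (votes n AltB AltC p)) * of_bool (h (votes n AltC AltA p)))
      + measure_pmf.expectation D (\<lambda>p. of_bool (h (votes n AltC AltA p)) * of_bool (f (votes n AltA AltB p)))"
proof -
  let ?f = "\<lambda>p. of_bool (f (votes n AltA AltB p)) :: real"
  let ?g = "\<lambda>p. of_bool (g (votes n AltB AltC p)) :: real"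
  let ?h = "\<lambda>p. of_bool (h (votes n AltC AltA p)) :: real"
  have int: "integrable (measure_pmf D) \<psi>" for \<psi> :: "_ \<Rightarrow> real"
    using D by (rule integrable_measure_pmf_finite)
  have "irrational_prob n D f g h =
      measure_pmf.expectation D (indicator {p. (f (votes n AltA AltB p) \<and> g (votes n AltB AltC p) \<and> h (votes n AltC AltA p)) \<or>
         (\<not> f (votes n AltA AltB p) \<and> \<not> g (votes n AltB AltC p) \<and> \<not> h (votes n AltC AltA p))})"
    unfolding irrational_prob_def by simp
  also have "\<dots> = measure_pmf.expectation D
      (\<lambda>p. 1 - ?f p - ?g p - ?h p + ?f p * ?g p + ?g p * ?h p + ?h p * ?f p)"
    by (intro Bochner_Integration.integral_cong refl) (simp add: indicator_def)
  also have "\<dots> = 1 - measure_pmf.expectation D ?f - measure_pmf.expectation D ?g - measure_pmf.expectation D ?h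
      + measure_pmf.expectation D (\<lambda>p. ?f p * ?g p) + measure_pmf.expectation D (\<lambda>p. ?g p * ?h p)
      + measure_pmf.expectation D (\<lambda>p. ?h p * ?f p)"
    by (simp only: Bochner_Integration.integral_add Bochner_Integration.integral_diff int) simp
  finally show ?thesis .
qed

lemma irrational_prob_even_product:
  assumes abc: "\<alpha> \<ge> 0" "\<beta> \<ge> 0" "\<gamma> \<ge> 0" "\<alpha> + \<beta> + \<gamma> = 1/2"
    and gh: "\<And>x. x \<in> cube n \<Longrightarrow> g x = f x" "\<And>x. x \<in> cube n \<Longrightarrow> h x = f x"
    and bal: "fourier_coeff n f {} = 1 / 2"
  shows "irrational_prob n (even_product_pmf n \<alpha> \<beta> \<gamma>) f g h =
      (\<Sum>S\<in>Pow {1..n}. (fourier_coeff n f S)\<^sup>2 *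
        ((4*\<alpha> - 1) ^ card S + (4*\<beta> - 1) ^ card S + (4*\<gamma> - 1) ^ card S)) - 1 / 2"
    and "(\<Sum>S\<in>Pow {1..n}. (fourier_coeff n f S)\<^sup>2) = 1 / 2"
proof -
  define D where "D = map_pmf ordering_of_triple (even_triple_pmf \<alpha> \<beta> \<gamma>)"
  have even: "even_product_pmf n \<alpha> \<beta> \<gamma> = Pi_pmf {1..n} undefined (\<lambda>_. D)"
    by (simp add: even_product_pmf_def D_def)
  have fin: "finite (set_pmf D)"
    by (simp add: D_def)
  then have fin': "finite (set_pmf (Pi_pmf {1..n} undefined (\<lambda>_. D)))"
    by (simp add: set_Pi_pmf finite_PiE_dflt)
  define u where "u r \<longleftrightarrow> (AltA, AltB) \<in> r" for r :: ordering
  define v where "v r \<longleftrightarrow> (AltB, AltC) \<in> r" for r :: ordering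
  define w where "w r \<longleftrightarrow> (AltC, AltA) \<in> r" for r :: ordering
  have votes: "votes n AltA AltB = (\<lambda>p. \<lambda>i\<in>{1..n}. u (p i))"
      "votes n AltB AltC = (\<lambda>p. \<lambda>i\<in>{1..n}. v (p i))"
      "votes n AltC AltA = (\<lambda>p. \<lambda>i\<in>{1..n}. w (p i))"
    by (simp_all add: votes_def u_def v_def w_def fun_eq_iff)
  note E = expectation_even_triple [OF abc]
  \<comment> \<open>Opposite triples have equal weight, so every spin has mean 0.\<close>
  have mean: "measure_pmf.expectation D (\<lambda>r. spin (u r)) = 0"
      "measure_pmf.expectation D (\<lambda>r. spin (v r)) = 0"
      "measure_pmf.expectation D (\<lambda>r. spin (w r)) = 0"
    by (simp_all add: D_def E u_def v_def w_def del: ordering_of_triple.simps)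
  \<comment> \<open>The first two votes agree with probability 2\<alpha>, which gives 2\<alpha> - (1
    - 2\<alpha>); the next two cases are analogous. The last correlation serves Parseval's
    identity.\<close>
  have corr: "measure_pmf.expectation D (\<lambda>r. spin (u r) * spin (v r)) = 4 * \<alpha> - 1"
      "measure_pmf.expectation D (\<lambda>r. spin (v r) * spin (w r)) = 4 * \<beta> - 1"
      "measure_pmf.expectation D (\<lambda>r. spin (w r) * spin (u r)) = 4 * \<gamma> - 1"
      "measure_pmf.expectation D (\<lambda>r. spin (u r) * spin (u r)) = 1"
    using abc(4) by (simp_all add: D_def E u_def v_def w_def del: ordering_of_triple.simps)
  have coeff: "fourier_coeff n g = fourier_coeff n f" "fourier_coeff n h = fourier_coeff n f"
    using gh by (auto intro: fourier_coeff_cong)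
  note single = expectation_choice [OF fin]
  note pair = expectation_choice_choice [OF fin]
  show "irrational_prob n (even_product_pmf n \<alpha> \<beta> \<gamma>) f g h =
      (\<Sum>S\<in>Pow {1..n}. (fourier_coeff n f S)\<^sup>2 *
        ((4*\<alpha> - 1) ^ card S + (4*\<beta> - 1) ^ card S + (4*\<gamma> - 1) ^ card S)) - 1 / 2"
    unfolding even irrational_prob_eq [OF fin'] votes
      single [OF mean(1)] single [OF mean(2)] single [OF mean(3)]
      pair [OF mean(1,2) corr(1)] pair [OF mean(2,3) corr(2)] pair [OF mean(3,1) corr(3)] coeff bal
    by (simp add: power2_eq_square distrib_left sum.distrib)
  have "(\<Sum>S\<in>Pow {1..n}. (fourier_coeff n f S)\<^sup>2) =
      (\<Sum>S\<in>Pow {1..n}. fourier_coeff n f S * fourier_coeff n f S * 1 ^ card S)"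
    by (simp add: power2_eq_square)
  also have "\<dots> = measure_pmf.expectation (Pi_pmf {1..n} undefined (\<lambda>_. D))
      (\<lambda>p. of_bool (f (\<lambda>i\<in>{1..n}. u (p i))) * of_bool (f (\<lambda>i\<in>{1..n}. u (p i))))"
    by (rule pair [OF mean(1,1) corr(4), symmetric])
  also have "\<dots> = measure_pmf.expectation (Pi_pmf {1..n} undefined (\<lambda>_. D))
      (\<lambda>p. of_bool (f (\<lambda>i\<in>{1..n}. u (p i))))"
    \<comment> \<open>A 0/1 value equals its square, so the total Fourier weight is the mean of
      \<open>f\<close>.\<close>
    by (simp only: of_bool_conj [symmetric] conj_absorb)
  also have "\<dots> = 1 / 2"
    unfolding single [OF mean(1)] bal ..
  finally show "(\<Sum>S\<in>Pow {1..n}. (fourier_coeff n f S)\<^sup>2) = 1 / 2" .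
qed

lemma sum_Pow_levels:
  fixes \<phi> :: "nat set \<Rightarrow> real"
  shows "(\<Sum>S\<in>Pow {1..n}. \<phi> S) = \<phi> {} + (\<Sum>i=1..n. \<phi> {i}) + (\<Sum>S | S \<subseteq> {1..n} \<and> card S \<ge> 2. \<phi> S)"
proof -
  have Pow: "Pow {1..n} = insert {} ((\<lambda>i. {i}) ` {1..n} \<union> {S. S \<subseteq> {1..n} \<and> card S \<ge> 2})" (is "_ = ?R")
  proof (intro equalityI subsetI)
    fix S assume S: "S \<in> Pow {1..n}"
    then have fin: "finite S"
      by (auto intro: finite_subset)
    consider "card S = 0" | "card S = 1" | "card S \<ge> 2"
      by linarith
    then show "S \<in> ?R"
      using S fin by cases (auto simp: card_1_singleton_iff One_nat_def)
  qed auto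
  have fin: "finite {S. S \<subseteq> {1..n} \<and> card S \<ge> 2}"
    by (rule finite_subset [of _ "Pow {1..n}"]) auto
  have "(\<Sum>S\<in>Pow {1..n}. \<phi> S) = sum \<phi> ?R"
    by (simp only: Pow)
  also have "\<dots> = \<phi> {} + sum \<phi> ((\<lambda>i. {i}) ` {1..n} \<union> {S. S \<subseteq> {1..n} \<and> card S \<ge> 2})"
    using fin by (intro sum.insert) auto
  also have "sum \<phi> ((\<lambda>i. {i}) ` {1..n} \<union> {S. S \<subseteq> {1..n} \<and> card S \<ge> 2}) =
      sum \<phi> ((\<lambda>i. {i}) ` {1..n}) + (\<Sum>S | S \<subseteq> {1..n} \<and> card S \<ge> 2. \<phi> S)"
    using fin by (intro sum.union_disjoint) auto
  also have "sum \<phi> ((\<lambda>i. {i}) ` {1..n}) = (\<Sum>i=1..n. \<phi> {i})"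
    by (subst sum.reindex) auto
  finally show ?thesis
    by (simp only: add.assoc)
qed

lemma irrational_prob_ge:
  assumes abc: "\<alpha> \<ge> 0" "\<beta> \<ge> 0" "\<gamma> \<ge> 0" "\<alpha> + \<beta> + \<gamma> = 1/2"
    and F: "gswf n F" "has_choice_functions n F f g h" "neutral n F" "symmetric n F"
  shows "irrational_prob n (even_product_pmf n \<alpha> \<beta> \<gamma>) f g h
    \<ge> (1/4 - d_m n) * (1 + (4*\<alpha> - 1)^3 + (4*\<beta> - 1)^3 + (4*\<gamma> - 1)^3)"
proof -
  note choice = neutral_choice_functions [OF F(1-3)]
  define c where "c S = (fourier_coeff n f S)\<^sup>2" for S
  define e where "e k = 1 + (4*\<alpha> - 1)^k + (4*\<beta> - 1)^k + (4*\<gamma> - 1)^k" for k :: nat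
  let ?H = "{S. S \<subseteq> {1..n} \<and> card S \<ge> 2}"
  have bal: "fourier_coeff n f {} = 1 / 2"
    using choice(3) by (rule fourier_coeff_empty_of_antisymmetric)
  have W: "irrational_prob n (even_product_pmf n \<alpha> \<beta> \<gamma>) f g h =
      (\<Sum>S\<in>Pow {1..n}. c S *
        ((4*\<alpha> - 1) ^ card S + (4*\<beta> - 1) ^ card S + (4*\<gamma> - 1) ^ card S)) - 1 / 2"
      "(\<Sum>S\<in>Pow {1..n}. c S) = 1 / 2"
    unfolding c_def
    by (rule irrational_prob_even_product [OF abc _ _ bal]; simp only: choice(1,2))+
  \<comment> \<open>The value 4 against the weight 1/4 of the empty set cancels the constant -1
    below; level one drops out because the correlations sum to -1.\<close>
  have e: "e 0 = 4" "e 1 = 0"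
    using abc(4) by (simp_all add: e_def)
  have e3: "e 3 \<ge> 0"
    unfolding e_def cubic_defect_eq [OF abc(4)] using abc by simp
  have level1: "(\<Sum>i=1..n. c {i}) \<le> d_m n"
    unfolding c_def using symmetric_level_one_eq [OF F(2,4)] by (rule level_one_weight_le_d_m)
  have c0: "c {} = 1 / 4"
    by (simp add: c_def bal power2_eq_square)
  have "(1/4 - d_m n) * e 3 \<le> (1/4 - (\<Sum>i=1..n. c {i})) * e 3"
    using level1 e3 by (intro mult_right_mono) auto
  also have "1/4 - (\<Sum>i=1..n. c {i}) = (\<Sum>S\<in>?H. c S)"
    using W(2) sum_Pow_levels [of c n] c0 by simp
  also have "(\<Sum>S\<in>?H. c S) * e 3 \<le> (\<Sum>S\<in>?H. c S * e (card S))"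
    unfolding sum_distrib_right
  proof (intro sum_mono mult_left_mono)
    fix S assume "S \<in> ?H"
    then show "e 3 \<le> e (card S)"
      using power_sum_ge_cubic [OF abc, of "card S"] by (simp add: e_def)
  qed (simp add: c_def)
  also have "\<dots> = (\<Sum>S\<in>Pow {1..n}. c S * e (card S)) - 1"
    using sum_Pow_levels [of "\<lambda>S. c S * e (card S)" n] by (simp add: c0 e e(2) [unfolded One_nat_def])
  \<comment> \<open>The summand 1 in \<open>e\<close> contributes the total weight 1/2, which turns
    the constant -1 into -1/2.\<close>
  also have "\<dots> = irrational_prob n (even_product_pmf n \<alpha> \<beta> \<gamma>) f g h"
    unfolding W(1) using W(2) by (simp add: e_def distrib_left sum.distrib)
  finally show ?thesis
    unfolding e_def .
qed

text \<open>Strict positivity is stated for at least two voters and positive weights: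
  \<open>1/4 - d_m n\<close> is 0 for \<open>n = 1\<close>, and the other factor,
  192\<alpha>\<beta>\<gamma>, is 0 when a weight is 0. The approximate value of \<open>d_m\<close>
  is expressed as a limit.\<close>

theorem theorem3p3:
  fixes \<alpha> \<beta> \<gamma> :: real
  assumes "\<alpha> \<ge> 0" and "\<beta> \<ge> 0" and "\<gamma> \<ge> 0" and "\<alpha> + \<beta> + \<gamma> = 1/2"
  shows "(\<forall>n F f g h. gswf n F \<and> IIA n F \<and> has_choice_functions n F f g h \<and> neutral n F \<and> symmetric n F \<longrightarrow>
            irrational_prob n (even_product_pmf n \<alpha> \<beta> \<gamma>) f g h
              \<ge> (1/4 - d_m n) * (1 + (4*\<alpha> - 1)^3 + (4*\<beta> - 1)^3 + (4*\<gamma> - 1)^3) \<and>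
            (n \<ge> 2 \<and> \<alpha> > 0 \<and> \<beta> > 0 \<and> \<gamma> > 0 \<longrightarrow>
              (1/4 - d_m n) * (1 + (4*\<alpha> - 1)^3 + (4*\<beta> - 1)^3 + (4*\<gamma> - 1)^3) > 0)) \<and>
         (\<alpha> > 0 \<and> \<beta> > 0 \<and> \<gamma> > 0 \<longrightarrow>
            (\<exists>c>0. \<forall>n F f g h. n \<ge> 2 \<and> gswf n F \<and> IIA n F \<and> has_choice_functions n F f g h \<and>
               neutral n F \<and> symmetric n F \<longrightarrow>
               irrational_prob n (even_product_pmf n \<alpha> \<beta> \<gamma>) f g h > c)) \<and>
         d_m \<longlonglongrightarrow> 1 / (2 * pi)"
proof -
  define K where "K = 1 + (4*\<alpha> - 1)^3 + (4*\<beta> - 1)^3 + (4*\<gamma> - 1)^3"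
  have K: "K = 192 * \<alpha> * \<beta> * \<gamma>"
    unfolding K_def by (rule cubic_defect_eq [OF assms(4)])
  have lower: "irrational_prob n (even_product_pmf n \<alpha> \<beta> \<gamma>) f g h \<ge> (1/4 - d_m n) * K"
    if "gswf n F" "has_choice_functions n F f g h" "neutral n F" "symmetric n F" for n F f g h
    unfolding K_def by (rule irrational_prob_ge [OF assms that])
  \<comment> \<open>The bound 3/16 on \<open>d_m\<close> leaves a gap of at least 1/16; halving it
    makes the inequality strict. As \<open>K / 32\<close> depends only on the weights, it is the
    uniform constant.\<close>
  have gap: "K / 32 < (1/4 - d_m n) * K" "0 < (1/4 - d_m n) * K"
    if "n \<ge> 2" "\<alpha> > 0" "\<beta> > 0" "\<gamma> > 0" for n
  proof -
    have "K > 0"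
      using that by (simp add: K)
    then have "1 / 32 * K < (1/4 - d_m n) * K"
      using d_m_le [OF that(1)] by (intro mult_strict_right_mono) auto
    then show "K / 32 < (1/4 - d_m n) * K" "0 < (1/4 - d_m n) * K"
      using \<open>K > 0\<close> by auto
  qed
  have uniform: "\<exists>c>0. \<forall>n F f g h. n \<ge> 2 \<and> gswf n F \<and> IIA n F \<and> has_choice_functions n F f g h \<and>
      neutral n F \<and> symmetric n F \<longrightarrow> irrational_prob n (even_product_pmf n \<alpha> \<beta> \<gamma>) f g h > c"
    if pos: "\<alpha> > 0" "\<beta> > 0" "\<gamma> > 0"
  proof (intro exI [of _ "K / 32"] conjI allI impI)
    show "K / 32 > 0"
      using pos by (simp add: K)
  next
    fix n F f g h
    assume "n \<ge> 2 \<and> gswf n F \<and> IIA n F \<and> has_choice_functions n F f g h \<and> neutral n F \<and> symmetric n F"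
    then show "irrational_prob n (even_product_pmf n \<alpha> \<beta> \<gamma>) f g h > K / 32"
      using gap(1) [of n] pos lower [of n F f g h] by linarith
  qed
  show ?thesis
    unfolding K_def [symmetric] using lower gap(2) uniform d_m_tendsto by blast
qed

end
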